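(* Let $(B,\Lambda,\underline v)$ be a bow diagram of affine type A with $\underline v\in\mathbb N^{\mathcal I^s}$ and let $(B,\Lambda,\underline v^{new})$ be a bow diagram obtained from $(B,\Lambda,\underline v)$ via supersymmetric increments between x-points. If there exists $\lambda\in\mathbb C^{\mathcal I}$ such that $\mu^{-1}_{(B,\Lambda,\underline v)}(\lambda)\ne\varnothing$, then $\mu^{-1}_{(B,\Lambda,\underline v^{new})}(\lambda)\neq\varnothing$.
   Context: $\mathbb N=\{0,1,2,\dots\}$. **Bow diagrams.** Fix $n,w\ge 0$ with $n+w\ge1$. An affine type A bow diagram $(B,\Lambda,\underline v)$ consists of an anticlockwise oriented circle carrying $n$ arrows (set $\mathcal E$) and a set $\Lambda$ of $w$ x-points. Between the head of an arrow and the tail of the next arrow (anticlockwise) there is a wavy line; $\mathcal I$ is the set of wavy lines (if $n=1$ there is one wavy line, from the head to the tail of the unique arrow; if $n=0$ there is one closed wavy line). The x-points lie on the wavy lines and divide them into segments; $\mathcal I^s$ is the set of segments, i.e. of the $n+w$ arcs between consecutive elements of $\mathcal E\sqcup\Lambda$. The dimension vector is $\underline v=(v_\zeta)\in\mathbb Z^{\mathcal I^s}$. For an arrow $e$, $v_{t(e)},v_{h(e)}$ are the dimensions of the segments at its tail and head. For an x-point $x$, $\zeta_x^-,\zeta_x^+$ are the segments just before and just after $x$ anticlockwise, with dimensions $v_x^\pm$. **Supersymmetric increments between x-points.** $(B,\Lambda,\underline v')$ is obtained from $(B,\Lambda,\underline v)$ via a supersymmetric increment between two x-points $x\neq x'$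 if $v'_\zeta-v_\zeta\ge0$ for all $\zeta$ and $v'_\zeta-v_\zeta$ depends only on which of the two arcs into which the circle is cut by $x,x'$ contains $\zeta$. The term also refers to successive applications of these operations. **Moment map.** Let $\underline v\in\mathbb N^{\mathcal I^s}$. For $e\in\mathcal E$ let $\mathcal M^e$ be the space of pairs $(C_e,D_e)$, $C_e:\mathbb C^{v_{t(e)}}\to\mathbb C^{v_{h(e)}}$, $D_e:\mathbb C^{v_{h(e)}}\to\mathbb C^{v_{t(e)}}$ linear. For $x\in\Lambda$ let $\mathcal M^x$ be the space of tuples $(A_x,B_x^-,B_x^+,a_x,b_x)$ of linear maps $A_x:\mathbb C^{v_x^-}\to\mathbb C^{v_x^+}$, $B_x^\pm\in\mathrm{End}(\mathbb C^{v_x^\pm})$, $a_x:\mathbb C\to\mathbb C^{v_x^+}$, $b_x:\mathbb C^{v_x^-}\to\mathbb C$ with (1) $B_x^+A_x-A_xB_x^-+a_xb_x=0$; (2) no nonzero $B_x^-$-invariant subspace is contained in $\ker A_x\cap\ker b_x$; (3) no proper $B_x^+$-invariant subspace of $\mathbb C^{v_x^+}$ contains $\mathrm{Im}A_x+\mathrm{Im}\,a_x$. Put $\widetilde{\mathcal M}=\prod_x\mathcal M^x\times\bigoplus_e\mathcal M^e$. The map $\mu=\mu_{(B,\Lambda,\underline v)}:\widetilde{\mathcal M}\to\bigoplus_\zeta\mathfrak{gl}(v_\zeta)$ has $\zeta$-component equal to the sum of the contributions of the two neighbours of $\zeta$: if the element just before $\zeta$ (anticlockwise) is an arrow $e$ it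 contributes $C_eD_e$, if it is an x-point $x$ it contributes $-B_x^+$; if the element just after $\zeta$ is an arrow $e$ it contributes $-D_eC_e$, if it is an x-point $x$ it contributes $B_x^-$. A parameter $\lambda\in\mathbb C^{\mathcal I}$ is viewed in $\bigoplus_\zeta\mathfrak{gl}(v_\zeta)$ as $\lambda_\sigma\mathrm{Id}$ on the first segment of each wavy line $\sigma$ and $0$ on the other segments (if $n=0$, a fixed segment is designated as first). *)

theory Defs
  imports Jordan_Normal_Form.VS_Connect Jordan_Normal_Form.Matrix_Kernel
begin

section \<open>Affine type A bow diagrams\<close>

text \<open>
  The elements of \<open>\<E> \<squnion> \<Lambda>\<close> are listed in anticlockwise order, starting anywhere on the circle;
  an element is identified with its position in that list and arrows point anticlockwise.
  Segment number \<open>i\<close> is the arc just after element \<open>i\<close> (so just before element \<open>i + 1\<close>, read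
  cyclically). The field \<open>base_seg\<close> is the segment designated as first segment of the closed wavy
  line of a diagram without arrows; it plays no role when there are arrows.
\<close>

datatype circle_elem = Arrow | XPoint

record bow =
  circle :: "circle_elem list"
  base_seg :: nat

definition size_bow :: "bow \<Rightarrow> nat" where
  "size_bow B = length (circle B)"

definition bow_diagram :: "bow \<Rightarrow> bool" where
  "bow_diagram B \<longleftrightarrow> size_bow B \<ge> 1 \<and> base_seg B < size_bow B"

definition arrows :: "bow \<Rightarrow> nat set" where
  "arrows B = {i. i < size_bow B \<and> circle B ! i = Arrow}"

definition xpoints :: "bow \<Rightarrow> nat set" where
  "xpoints B = {i. i < size_bow B \<and> circle B ! i = XPoint}"

definition segments :: "bow \<Rightarrow> nat set" where
  "segments B = {..<size_bow B}"

definition seg_before :: "bow \<Rightarrow> nat \<Rightarrow> nat" where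
  "seg_before B i = (i + size_bow B - 1) mod size_bow B"

definition seg_after :: "bow \<Rightarrow> nat \<Rightarrow> nat" where
  "seg_after B i = i"

definition elem_before :: "bow \<Rightarrow> nat \<Rightarrow> nat" where
  "elem_before B s = s"

definition elem_after :: "bow \<Rightarrow> nat \<Rightarrow> nat" where
  "elem_after B s = (s + 1) mod size_bow B"

text \<open>
  A wavy line is represented by its first segment: the one at the head of an arrow, or the
  designated one if there are no arrows. An element of \<open>\<complex>\<^sup>\<I>\<close> is a function on segments, of which only
  the values on \<open>wavy_lines\<close> are used.
\<close>

definition wavy_lines :: "bow \<Rightarrow> nat set" where
  "wavy_lines B = (if arrows B = {} then {base_seg B} else seg_after B ` arrows B)"

section \<open>Supersymmetric increments between x-points\<close>

text \<open>
  For \<open>x < x'\<close> the segments \<open>{x..<x'}\<close> are those on the arc running anticlockwise from \<open>x\<close> to \<open>x'\<close>,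
  and the remaining segments are those on the complementary arc. As the pair of x-points is
  unordered, \<open>x < x'\<close> expresses \<open>x \<noteq> x'\<close> without loss.
\<close>

definition susy_increment :: "bow \<Rightarrow> (nat \<Rightarrow> int) \<Rightarrow> (nat \<Rightarrow> int) \<Rightarrow> bool" where
  "susy_increment B v v' \<longleftrightarrow>
     (\<exists>x\<in>xpoints B. \<exists>x'\<in>xpoints B. x < x' \<and>
        (\<forall>s\<in>segments B. v' s - v s \<ge> 0) \<and>
        (\<forall>s\<in>segments B. \<forall>t\<in>segments B.
           (s \<in> {x..<x'} \<longleftrightarrow> t \<in> {x..<x'}) \<longrightarrow> v' s - v s = v' t - v t))"

definition susy_increments :: "bow \<Rightarrow> (nat \<Rightarrow> int) \<Rightarrow> (nat \<Rightarrow> int) \<Rightarrow> bool" where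
  "susy_increments B = (susy_increment B)\<^sup>*\<^sup>*"

section \<open>The moment map\<close>

text \<open>
  Linear maps from \<open>\<complex>\<^sup>m\<close> to \<open>\<complex>\<^sup>k\<close> are \<open>k \<times> m\<close> matrices. The moment map is only meaningful for dimension
  vectors that are nonnegative on all segments, where \<open>nat\<close> below loses nothing.
\<close>

abbreviation lin_subspace :: "nat \<Rightarrow> complex vec set \<Rightarrow> bool" where
  "lin_subspace k W \<equiv> VectorSpace.subspace class_ring W (module_vec TYPE(complex) k)"

definition invariant_under :: "complex mat \<Rightarrow> complex vec set \<Rightarrow> bool" where
  "invariant_under M W \<longleftrightarrow> (\<forall>u\<in>W. M *\<^sub>v u \<in> W)"

record arrow_data =
  Ce :: "complex mat"
  De :: "complex mat"

record xpoint_data =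
  Ax :: "complex mat"
  Bminus :: "complex mat"
  Bplus :: "complex mat"
  ax :: "complex mat"
  bx :: "complex mat"

definition arrow_space :: "nat \<Rightarrow> nat \<Rightarrow> arrow_data set" where
  "arrow_space vt vh = {d. Ce d \<in> carrier_mat vh vt \<and> De d \<in> carrier_mat vt vh}"

definition xpoint_space :: "nat \<Rightarrow> nat \<Rightarrow> xpoint_data set" where
  "xpoint_space vm vp = {d.
     Ax d \<in> carrier_mat vp vm \<and> Bminus d \<in> carrier_mat vm vm \<and> Bplus d \<in> carrier_mat vp vp \<and>
     ax d \<in> carrier_mat vp 1 \<and> bx d \<in> carrier_mat 1 vm \<and>
     Bplus d * Ax d - Ax d * Bminus d + ax d * bx d = 0\<^sub>m vp vm \<and>
     \<not> (\<exists>W. lin_subspace vm W \<and> W \<noteq> {0\<^sub>v vm} \<and> invariant_under (Bminus d) W \<and>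
            W \<subseteq> mat_kernel (Ax d) \<inter> mat_kernel (bx d)) \<and>
     \<not> (\<exists>W. lin_subspace vp W \<and> W \<noteq> carrier_vec vp \<and> invariant_under (Bplus d) W \<and>
            {Ax d *\<^sub>v u + ax d *\<^sub>v c | u c. u \<in> carrier_vec vm \<and> c \<in> carrier_vec 1} \<subseteq> W)}"

type_synonym bow_point = "(nat \<Rightarrow> xpoint_data) \<times> (nat \<Rightarrow> arrow_data)"

definition M_tilde :: "bow \<Rightarrow> (nat \<Rightarrow> int) \<Rightarrow> bow_point set" where
  "M_tilde B v =
     (\<Pi>\<^sub>E x\<in>xpoints B. xpoint_space (nat (v (seg_before B x))) (nat (v (seg_after B x)))) \<times>
     (\<Pi>\<^sub>E e\<in>arrows B. arrow_space (nat (v (seg_before B e))) (nat (v (seg_after B e))))"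

definition contrib_before :: "bow \<Rightarrow> bow_point \<Rightarrow> nat \<Rightarrow> complex mat" where
  "contrib_before B p s = (let i = elem_before B s in
     case circle B ! i of
       Arrow \<Rightarrow> Ce (snd p i) * De (snd p i)
     | XPoint \<Rightarrow> - Bplus (fst p i))"

definition contrib_after :: "bow \<Rightarrow> bow_point \<Rightarrow> nat \<Rightarrow> complex mat" where
  "contrib_after B p s = (let i = elem_after B s in
     case circle B ! i of
       Arrow \<Rightarrow> - (De (snd p i) * Ce (snd p i))
     | XPoint \<Rightarrow> Bminus (fst p i))"

definition moment_map :: "bow \<Rightarrow> bow_point \<Rightarrow> nat \<Rightarrow> complex mat" where
  "moment_map B p s = contrib_before B p s + contrib_after B p s"

definition param_mat :: "bow \<Rightarrow> (nat \<Rightarrow> int) \<Rightarrow> (nat \<Rightarrow> complex) \<Rightarrow> nat \<Rightarrow> complex mat" where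
  "param_mat B v l s =
     (if s \<in> wavy_lines B then l s \<cdot>\<^sub>m 1\<^sub>m (nat (v s)) else 0\<^sub>m (nat (v s)) (nat (v s)))"

definition moment_fibre :: "bow \<Rightarrow> (nat \<Rightarrow> int) \<Rightarrow> (nat \<Rightarrow> complex) \<Rightarrow> bow_point set" where
  "moment_fibre B v l =
     {p \<in> M_tilde B v. \<forall>s\<in>segments B. moment_map B p s = param_mat B v l s}"

end

theory Submission
  imports Defs Jordan_Normal_Form.Spectral_Radius
begin

text \<open>
  A supersymmetric increment is a succession of steps, each of which raises by one the dimensions of
  the segments of an arc between two x-points, so one such step has to be shown to preserve
  nonemptiness of the fibre. A point over the new dimension vector is obtained from one over the old
  dimension vector by attaching a one-dimensional space to every segment of the arc.
  
  Away from the two endpoints of the arc the new point is a direct sum. At an arrow \<open>e\<close> the new summand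
  has \<open>C = q\<^sub>e\<close> and \<open>D = 1\<close>; at an x-point \<open>x\<close> inside the arc it has \<open>A = 1\<close>, \<open>B\<^sup>- = B\<^sup>+ = - q\<^sub>x\<close> and
  \<open>a = b = 0\<close>. With this sign convention an element \<open>i\<close> of either kind contributes \<open>q\<^sub>i\<close> to the
  moment map on the new line of the segment after it and \<open>- q\<^sub>i\<close> on that of the segment before it, so
  that the moment map equation is \<open>q\<^sub>i - q\<^sub>j = \<lambda>\<close> for consecutive elements \<open>i\<close>, \<open>j\<close> of the arc, where
  \<open>\<lambda>\<close> is the parameter on the segment between them. As the arc is not the whole circle, this can be
  solved by summing the parameters along it, and a common constant can still be added to all \<open>q\<^sub>i\<close>.
  
  At an endpoint only one of the two spaces \<open>\<complex>\<^bsup>v\<^sup>-\<^esup>\<close>, \<open>\<complex>\<^bsup>v\<^sup>+\<^esup>\<close> grows, and a direct sum would violate one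
  of the two stability conditions. There the new line is attached through \<open>a\<close> (or \<open>b\<close>), which gets
  an entry \<open>1\<close>, and \<open>A\<close> gets a new row (or column) which repairs the equation
  \<open>B\<^sup>+ A - A B\<^sup>- + a b = 0\<close>. That row is the solution of a Sylvester equation, and it exists as soon as the
  new eigenvalue \<open>\<beta> = - q\<close> is not an eigenvalue of the old \<open>B\<^sup>\<plusminus>\<close>. The same genericity of \<open>\<beta>\<close> separates
  the new line from the old space and thereby yields stability and costability
  (\<open>stable_enlarge\<close>, \<open>costable_enlarge\<close>). Only finitely many values of the free constant violate it.
  
  Interior x-points, endpoints and x-points outside the arc are treated together in
  \<open>xpoint_space_enlarge\<close>; \<open>moment_fibre_increment_arc\<close> assembles the local pieces, and
  \<open>moment_fibre_susy_increment\<close> supplies the numbers \<open>q\<^sub>i\<close> for the two arcs.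
\<close>

section \<open>Matrices shifted by a scalar and block vectors\<close>

lemma lin_subspace_iff:
  "lin_subspace k W \<longleftrightarrow> W \<subseteq> carrier_vec k \<and> 0\<^sub>v k \<in> W \<and>
     (\<forall>u\<in>W. \<forall>w\<in>W. u + w \<in> W) \<and> (\<forall>c. \<forall>u\<in>W. c \<cdot>\<^sub>v u \<in> W)"
  (is "_ \<longleftrightarrow> ?R")
proof -
  interpret vec_space "TYPE(complex)" k .
  show ?thesis
    unfolding VectorSpace.subspace_def submodule_def
    using vectorspace_axioms module_axioms
    by (auto simp: class_ring_simps module_vec_simps)
qed

text \<open>
  The library writes \<open>char_matrix M \<beta>\<close> for \<open>M - \<beta>\<close>. It is invertible when \<open>\<beta>\<close> is not an eigenvalue, and
  its inverse solves the Sylvester equations below.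
\<close>

lemma char_matrix_mult_vec:
  assumes "M \<in> carrier_mat n n" "u \<in> carrier_vec n"
  shows "char_matrix M \<beta> *\<^sub>v u = M *\<^sub>v u + (- \<beta>) \<cdot>\<^sub>v u"
proof -
  have "((- \<beta>) \<cdot>\<^sub>m 1\<^sub>m n) *\<^sub>v u = (- \<beta>) \<cdot>\<^sub>v u"
    using assms by (intro eq_vecI) (auto simp: row_smult)
  then show ?thesis
    using assms unfolding char_matrix_def
    by (subst add_mult_distrib_mat_vec[where nr = n and nc = n]) auto
qed

lemma char_matrix_inverse:
  fixes M :: "complex mat"
  assumes M: "M \<in> carrier_mat n n" and "\<not> eigenvalue M \<beta>"
  obtains R where "R \<in> carrier_mat n n"
    "char_matrix M \<beta> * R = 1\<^sub>m n" "R * char_matrix M \<beta> = 1\<^sub>m n"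
proof -
  have "det (char_matrix M \<beta>) \<noteq> 0" using eigenvalue_det[OF M] assms(2) by auto
  from det_non_zero_imp_unit[OF char_matrix_closed[OF M] this, of "()"]
  show ?thesis using that unfolding Units_def ring_mat_def by auto
qed

lemma char_matrix_mult:
  assumes "M \<in> carrier_mat n n" "X \<in> carrier_mat n c"
  shows "char_matrix M \<beta> * X = M * X + (- \<beta>) \<cdot>\<^sub>m X"
  using assms unfolding char_matrix_def
  by (subst add_mult_distrib_mat[where nr = n and n = n and nc = c]) auto

lemma mult_char_matrix:
  assumes "M \<in> carrier_mat n n" "X \<in> carrier_mat r n"
  shows "X * char_matrix M \<beta> = X * M + (- \<beta>) \<cdot>\<^sub>m X"
proof -
  have "X * ((- \<beta>) \<cdot>\<^sub>m 1\<^sub>m n) = (- \<beta>) \<cdot>\<^sub>m X"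
    using assms mult_smult_distrib[of X r n "1\<^sub>m n" n "- \<beta>"] by simp
  then show ?thesis
    using assms unfolding char_matrix_def
    by (subst mult_add_distrib_mat[where nr = r and n = n and nc = n]) auto
qed

text \<open>
  \<open>enlarge k M c\<close> is the direct sum of \<open>M\<close> and the scalar \<open>c\<close> on \<open>\<complex>\<^sup>k\<close>. The size \<open>k\<close> is a parameter,
  although only \<open>0\<close> and \<open>1\<close> will occur, so that elements on and off the arc can be handled by the
  same formulas.
\<close>

definition enlarge :: "nat \<Rightarrow> complex mat \<Rightarrow> complex \<Rightarrow> complex mat" where
  "enlarge k M c = four_block_mat M (0\<^sub>m (dim_row M) k) (0\<^sub>m k (dim_col M)) (c \<cdot>\<^sub>m 1\<^sub>m k)"

lemma enlarge_carrier [simp]: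
  "M \<in> carrier_mat r c \<Longrightarrow> enlarge k M z \<in> carrier_mat (r + k) (c + k)"
  unfolding enlarge_def by auto

lemma enlarge_0: "enlarge 0 M z = M"
  unfolding enlarge_def by (intro eq_matI) auto

lemma enlarge_add:
  assumes "M \<in> carrier_mat r c" "N \<in> carrier_mat r c"
  shows "enlarge k M y + enlarge k N z = enlarge k (M + N) (y + z)"
  using assms unfolding enlarge_def by (intro eq_matI) auto

lemma enlarge_uminus: "- enlarge k M z = enlarge k (- M) (- z)"
  unfolding enlarge_def by (intro eq_matI) auto

lemma enlarge_scalar: "enlarge k (z \<cdot>\<^sub>m 1\<^sub>m n) z = z \<cdot>\<^sub>m 1\<^sub>m (n + k)"
  unfolding enlarge_def by (intro eq_matI) auto

lemma enlarge_zero: "enlarge k (0\<^sub>m r c) 0 = 0\<^sub>m (r + k) (c + k)"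
  unfolding enlarge_def by (intro eq_matI) auto

lemma enlarge_mult:
  assumes "M \<in> carrier_mat r n" "N \<in> carrier_mat n c"
  shows "enlarge k M y * enlarge k N z = enlarge k (M * N) (y * z)"
proof -
  have "(y \<cdot>\<^sub>m 1\<^sub>m k) * (z \<cdot>\<^sub>m 1\<^sub>m k) = (y * z) \<cdot>\<^sub>m 1\<^sub>m k"
    by (intro eq_matI) (auto simp: row_smult)
  then show ?thesis
    using assms unfolding enlarge_def
    by (subst mult_four_block_mat[where ?nr1.0 = r and ?nr2.0 = k and ?n1.0 = n and ?n2.0 = k
          and ?nc1.0 = c and ?nc2.0 = k]) auto
qed

lemma enlarge_mult_vec:
  assumes "M \<in> carrier_mat r c" "u \<in> carrier_vec c" "z \<in> carrier_vec k"
  shows "enlarge k M y *\<^sub>v (u @\<^sub>v z) = (M *\<^sub>v u) @\<^sub>v (y \<cdot>\<^sub>v z)"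
proof -
  have "(y \<cdot>\<^sub>m 1\<^sub>m k) *\<^sub>v z = y \<cdot>\<^sub>v z"
    using assms by (intro eq_vecI) (auto simp: row_smult)
  then show ?thesis
    using assms unfolding enlarge_def
    by (subst four_block_mat_mult_vec[where ?nr1.0 = r and ?nc1.0 = c and ?nr2.0 = k and ?nc2.0 = k])
      auto
qed

lemma append_vec_zero: "0\<^sub>v n @\<^sub>v 0\<^sub>v k = 0\<^sub>v (n + k)"
  by (intro eq_vecI) auto

lemma append_vec_smult: "c \<cdot>\<^sub>v (u @\<^sub>v z) = (c \<cdot>\<^sub>v u) @\<^sub>v (c \<cdot>\<^sub>v z)"
  by (intro eq_vecI) auto

lemma smult_vec_zero: "c \<cdot>\<^sub>v 0\<^sub>v k = (0\<^sub>v k :: complex vec)"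
  by (intro eq_vecI) auto

lemma mult_zero_vec: "M \<in> carrier_mat r n \<Longrightarrow> M *\<^sub>v 0\<^sub>v n = (0\<^sub>v r :: complex vec)"
  by (intro eq_vecI) auto

lemma one_by_one_mult_vec:
  "z \<in> carrier_vec 1 \<Longrightarrow> mat 1 1 (\<lambda>_. c) *\<^sub>v z = (c :: complex) \<cdot>\<^sub>v z"
  by (intro eq_vecI) (auto simp: scalar_prod_def)

lemma append_vec_split:
  assumes "w \<in> carrier_vec (n + k)"
  shows "\<exists>u\<in>carrier_vec n. \<exists>z\<in>carrier_vec k. w = u @\<^sub>v z"
  using assms vec_first_last_append[OF assms] by (metis vec_first_carrier vec_last_carrier)

text \<open>
  Applying \<open>M \<oplus> \<beta> - \<beta>\<close> kills the new summand. Since it preserves invariant subspaces, this is how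
  vectors of the old space are extracted from them.
\<close>

lemma enlarge_shift:
  assumes M: "M \<in> carrier_mat n n" and u: "u \<in> carrier_vec n" and z: "z \<in> carrier_vec k"
  shows "enlarge k M \<beta> *\<^sub>v (u @\<^sub>v z) + (- \<beta>) \<cdot>\<^sub>v (u @\<^sub>v z) = (char_matrix M \<beta> *\<^sub>v u) @\<^sub>v 0\<^sub>v k"
proof -
  have "\<beta> \<cdot>\<^sub>v z + (- \<beta>) \<cdot>\<^sub>v z = 0\<^sub>v k" using z by (intro eq_vecI) auto
  then show ?thesis
    using assms
    by (simp add: enlarge_mult_vec append_vec_smult char_matrix_mult_vec
        append_vec_add[where n = n and m = k])
qed

lemma append_cols_mult_vec:
  assumes "b \<in> carrier_mat r m" "c \<in> carrier_mat r k" "u \<in> carrier_vec m" "z \<in> carrier_vec k"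
  shows "four_block_mat b c (0\<^sub>m 0 m) (0\<^sub>m 0 k) *\<^sub>v (u @\<^sub>v z) = b *\<^sub>v u + c *\<^sub>v (z :: complex vec)"
  using assms
  by (subst four_block_mat_mult_vec[where ?nr1.0 = r and ?nc1.0 = m and ?nr2.0 = 0 and ?nc2.0 = k])
    (auto intro!: eq_vecI)

section \<open>Stability under enlargement\<close>

text \<open>
  Let \<open>W\<close> be an invariant subspace in the new kernels. Its intersection with the old space vanishes by
  the old stability. For \<open>u \<oplus> z\<close> in \<open>W\<close>, the shifted operator produces \<open>(M - \<beta>) u\<close> in this intersection,
  whence \<open>u = 0\<close> as \<open>\<beta>\<close> is not an eigenvalue; so \<open>W\<close> lies in the new summand, on which the new maps
  \<open>A'\<close>, \<open>b'\<close> have no common kernel.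
\<close>

lemma stable_enlarge:
  assumes M: "M \<in> carrier_mat m m" and ne: "\<not> eigenvalue M \<beta>"
    and A: "A \<in> carrier_mat p m" and b: "b \<in> carrier_mat 1 m"
    and stable: "\<And>W. lin_subspace m W \<Longrightarrow> invariant_under M W \<Longrightarrow>
      W \<subseteq> mat_kernel A \<inter> mat_kernel b \<Longrightarrow> W = {0\<^sub>v m}"
    and A': "\<And>u. u \<in> carrier_vec m \<Longrightarrow> u @\<^sub>v 0\<^sub>v k \<in> mat_kernel A' \<Longrightarrow> A *\<^sub>v u = 0\<^sub>v p"
    and b': "\<And>u. u \<in> carrier_vec m \<Longrightarrow> u @\<^sub>v 0\<^sub>v k \<in> mat_kernel b' \<Longrightarrow> b *\<^sub>v u = 0\<^sub>v 1"
    and new: "\<And>z. z \<in> carrier_vec k \<Longrightarrow> 0\<^sub>v m @\<^sub>v z \<in> mat_kernel A' \<inter> mat_kernel b' \<Longrightarrow> z = 0\<^sub>v k"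
    and W: "lin_subspace (m + k) W" and inv: "invariant_under (enlarge k M \<beta>) W"
    and ker: "W \<subseteq> mat_kernel A' \<inter> mat_kernel b'"
  shows "W = {0\<^sub>v (m + k)}"
proof -
  from W have Wc: "W \<subseteq> carrier_vec (m + k)" and W0: "0\<^sub>v (m + k) \<in> W"
    and Wadd: "\<And>u w. u \<in> W \<Longrightarrow> w \<in> W \<Longrightarrow> u + w \<in> W"
    and Wsm: "\<And>c u. u \<in> W \<Longrightarrow> c \<cdot>\<^sub>v u \<in> W"
    unfolding lin_subspace_iff by auto
  define W' where "W' = {u \<in> carrier_vec m. u @\<^sub>v 0\<^sub>v k \<in> W}"
  have "lin_subspace m W'"
    unfolding lin_subspace_iff
  proof (intro conjI ballI allI)
    show "W' \<subseteq> carrier_vec m" unfolding W'_def by auto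
    show "0\<^sub>v m \<in> W'" using W0 unfolding W'_def by (simp add: append_vec_zero)
    show "u + w \<in> W'" if "u \<in> W'" "w \<in> W'" for u w
      using that Wadd[of "u @\<^sub>v 0\<^sub>v k" "w @\<^sub>v 0\<^sub>v k"] unfolding W'_def
      by (auto simp: append_vec_add[where n = m and m = k])
    show "c \<cdot>\<^sub>v u \<in> W'" if "u \<in> W'" for c u
      using that Wsm[of "u @\<^sub>v 0\<^sub>v k" c] unfolding W'_def
      by (auto simp: append_vec_smult smult_vec_zero)
  qed
  moreover have "invariant_under M W'"
    unfolding invariant_under_def
  proof
    fix u assume u: "u \<in> W'"
    then have "enlarge k M \<beta> *\<^sub>v (u @\<^sub>v 0\<^sub>v k) \<in> W"
      using inv unfolding W'_def invariant_under_def by auto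
    then show "M *\<^sub>v u \<in> W'"
      using u M unfolding W'_def by (auto simp: enlarge_mult_vec smult_vec_zero)
  qed
  moreover have "W' \<subseteq> mat_kernel A \<inter> mat_kernel b"
  proof
    fix u assume "u \<in> W'"
    then have u: "u \<in> carrier_vec m" and "u @\<^sub>v 0\<^sub>v k \<in> mat_kernel A' \<inter> mat_kernel b'"
      using ker unfolding W'_def by auto
    with A'[OF u] b'[OF u] show "u \<in> mat_kernel A \<inter> mat_kernel b"
      using A b by (auto intro: mat_kernelI)
  qed
  ultimately have W'_zero: "W' = {0\<^sub>v m}" by (rule stable)
  have "w = 0\<^sub>v (m + k)" if w: "w \<in> W" for w
  proof -
    obtain u z where uz: "u \<in> carrier_vec m" "z \<in> carrier_vec k" "w = u @\<^sub>v z"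
      using append_vec_split[of w m k] w Wc by blast
    have "enlarge k M \<beta> *\<^sub>v w + (- \<beta>) \<cdot>\<^sub>v w \<in> W"
      using w inv Wadd Wsm unfolding invariant_under_def by blast
    then have "char_matrix M \<beta> *\<^sub>v u \<in> W'"
      using uz M unfolding W'_def by (simp add: enlarge_shift mult_mat_vec_carrier[of _ m m])
    with W'_zero have "char_matrix M \<beta> *\<^sub>v u = 0\<^sub>v m" by simp
    then have "u = 0\<^sub>v m"
      using ne uz(1) eigenvector_char_matrix[OF M] unfolding eigenvalue_def by blast
    then have wz: "w = 0\<^sub>v m @\<^sub>v z" using uz(3) by (simp only:)
    have "z = 0\<^sub>v k"
      using new[OF uz(2)] subsetD[OF ker w] unfolding wz .
    then show ?thesis unfolding wz by (simp only: append_vec_zero)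
  qed
  then show ?thesis using W0 by blast
qed

text \<open>
  This is dual to the previous lemma, with projection instead of intersection: by the old costability an invariant
  subspace \<open>W\<close> containing the generators \<open>G'\<close> projects onto the old space. Every \<open>u\<close> in the old space is \<open>(M - \<beta>) u'\<close>, and
  the shifted operator maps a vector of \<open>W\<close> above \<open>u'\<close> to \<open>u \<oplus> 0\<close>, so \<open>W\<close> contains the old space. The
  generators then provide the new summand.
\<close>

lemma costable_enlarge:
  assumes M: "M \<in> carrier_mat p p" and ne: "\<not> eigenvalue M \<beta>"
    and costable: "\<And>W. lin_subspace p W \<Longrightarrow> invariant_under M W \<Longrightarrow> G \<subseteq> W \<Longrightarrow> W = carrier_vec p"
    and G: "G \<subseteq> carrier_vec p"
    and lift: "\<And>g. g \<in> G \<Longrightarrow> \<exists>z\<in>carrier_vec j. g @\<^sub>v z \<in> G'"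
    and new: "\<And>z. z \<in> carrier_vec j \<Longrightarrow> \<exists>u\<in>carrier_vec p. u @\<^sub>v z \<in> G'"
    and W: "lin_subspace (p + j) W" and inv: "invariant_under (enlarge j M \<beta>) W"
    and sub: "G' \<subseteq> W"
  shows "W = carrier_vec (p + j)"
proof -
  from W have Wc: "W \<subseteq> carrier_vec (p + j)" and W0: "0\<^sub>v (p + j) \<in> W"
    and Wadd: "\<And>u w. u \<in> W \<Longrightarrow> w \<in> W \<Longrightarrow> u + w \<in> W"
    and Wsm: "\<And>c u. u \<in> W \<Longrightarrow> c \<cdot>\<^sub>v u \<in> W"
    unfolding lin_subspace_iff by auto
  define W' where "W' = {u \<in> carrier_vec p. \<exists>z\<in>carrier_vec j. u @\<^sub>v z \<in> W}"
  have "lin_subspace p W'"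
    unfolding lin_subspace_iff
  proof (intro conjI ballI allI)
    show "W' \<subseteq> carrier_vec p" unfolding W'_def by auto
    show "0\<^sub>v p \<in> W'" using W0 unfolding W'_def
      by (auto simp: append_vec_zero intro!: bexI[of _ "0\<^sub>v j"])
    show "u + w \<in> W'" if uw: "u \<in> W'" "w \<in> W'" for u w
    proof -
      obtain y z where "y \<in> carrier_vec j" "z \<in> carrier_vec j" "u @\<^sub>v y \<in> W" "w @\<^sub>v z \<in> W"
        using uw unfolding W'_def by auto
      moreover from this have "(u + w) @\<^sub>v (y + z) \<in> W"
        using uw Wadd[of "u @\<^sub>v y" "w @\<^sub>v z"] unfolding W'_def
        by (auto simp: append_vec_add[where n = p and m = j])
      ultimately show ?thesis using uw unfolding W'_def by (auto intro!: bexI[of _ "y + z"])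
    qed
    show "c \<cdot>\<^sub>v u \<in> W'" if u: "u \<in> W'" for c u
    proof -
      obtain y where "y \<in> carrier_vec j" "u @\<^sub>v y \<in> W"
        using u unfolding W'_def by auto
      then show ?thesis using u Wsm[of "u @\<^sub>v y" c] unfolding W'_def
        by (auto simp: append_vec_smult intro!: bexI[of _ "c \<cdot>\<^sub>v y"])
    qed
  qed
  moreover have "invariant_under M W'"
    unfolding invariant_under_def
  proof
    fix u assume "u \<in> W'"
    then obtain y where u: "u \<in> carrier_vec p" and y: "y \<in> carrier_vec j" and "u @\<^sub>v y \<in> W"
      unfolding W'_def by auto
    then have "enlarge j M \<beta> *\<^sub>v (u @\<^sub>v y) \<in> W"
      using inv unfolding invariant_under_def by auto
    then show "M *\<^sub>v u \<in> W'"
      using u y M unfolding W'_def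
      by (auto simp: enlarge_mult_vec intro!: bexI[of _ "\<beta> \<cdot>\<^sub>v y"])
  qed
  moreover have "G \<subseteq> W'"
    using G lift sub unfolding W'_def by blast
  ultimately have W'_all: "W' = carrier_vec p" by (rule costable)
  obtain R where R: "R \<in> carrier_mat p p" "char_matrix M \<beta> * R = 1\<^sub>m p"
    using char_matrix_inverse[OF M ne] by metis
  have old: "u @\<^sub>v 0\<^sub>v j \<in> W" if u: "u \<in> carrier_vec p" for u
  proof -
    have Ru: "R *\<^sub>v u \<in> carrier_vec p" using R u by auto
    then obtain z where z: "z \<in> carrier_vec j" "(R *\<^sub>v u) @\<^sub>v z \<in> W"
      using W'_all unfolding W'_def by auto
    then have "enlarge j M \<beta> *\<^sub>v ((R *\<^sub>v u) @\<^sub>v z) + (- \<beta>) \<cdot>\<^sub>v ((R *\<^sub>v u) @\<^sub>v z) \<in> W"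
      using inv Wadd Wsm unfolding invariant_under_def by blast
    moreover have "char_matrix M \<beta> *\<^sub>v (R *\<^sub>v u) = u"
      using R u M by (subst assoc_mult_mat_vec[symmetric, where ?n\<^sub>1 = p and ?n\<^sub>2 = p and ?n\<^sub>3 = p]) auto
    ultimately show ?thesis using enlarge_shift[OF M Ru z(1)] by simp
  qed
  have "w \<in> W" if w: "w \<in> carrier_vec (p + j)" for w
  proof -
    obtain u z where uz: "u \<in> carrier_vec p" "z \<in> carrier_vec j" "w = u @\<^sub>v z"
      using append_vec_split[OF w] by blast
    obtain y where y: "y \<in> carrier_vec p" "y @\<^sub>v z \<in> W" using new[OF uz(2)] sub by blast
    have "w = (y @\<^sub>v z) + ((u - y) @\<^sub>v 0\<^sub>v j)"
      using uz y by (intro eq_vecI) auto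
    then show ?thesis using Wadd[OF y(2) old[of "u - y"]] uz y by auto
  qed
  with Wc show ?thesis by auto
qed

section \<open>Enlarging the data at x-points and arrows\<close>

text \<open>
  For \<open>k = j = 1\<close> this is the direct sum at an x-point inside the arc; for \<open>k = 0\<close>, \<open>j = 1\<close> and for \<open>k = 1\<close>,
  \<open>j = 0\<close> it is the extension at the first and last endpoint of the arc; for \<open>k = j = 0\<close> nothing changes. All cases
  use the same block matrices, with blocks that may be empty.
\<close>

lemma xpoint_space_enlarge:
  assumes d: "d \<in> xpoint_space m p"
    and nem: "\<not> eigenvalue (Bminus d) \<beta>" and nep: "\<not> eigenvalue (Bplus d) \<beta>"
    and k: "k \<le> 1" and j: "j \<le> 1"
  shows "\<exists>d'\<in>xpoint_space (m + k) (p + j).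
    Bminus d' = enlarge k (Bminus d) \<beta> \<and> Bplus d' = enlarge j (Bplus d) \<beta>"
proof -
  define A Bm Bp a b where "A = Ax d" and "Bm = Bminus d" and "Bp = Bplus d"
    and "a = ax d" and "b = bx d"
  have A: "A \<in> carrier_mat p m" and Bm: "Bm \<in> carrier_mat m m" and Bp: "Bp \<in> carrier_mat p p"
    and a: "a \<in> carrier_mat p 1" and b: "b \<in> carrier_mat 1 m"
    and rel: "Bp * A - A * Bm + a * b = 0\<^sub>m p m"
    and stable: "\<And>W. lin_subspace m W \<Longrightarrow> invariant_under Bm W \<Longrightarrow>
      W \<subseteq> mat_kernel A \<inter> mat_kernel b \<Longrightarrow> W = {0\<^sub>v m}"
    and costable: "\<And>W. lin_subspace p W \<Longrightarrow> invariant_under Bp W \<Longrightarrow>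
      {A *\<^sub>v u + a *\<^sub>v c | u c. u \<in> carrier_vec m \<and> c \<in> carrier_vec 1} \<subseteq> W \<Longrightarrow>
      W = carrier_vec p"
    using d unfolding xpoint_space_def A_def Bm_def Bp_def a_def b_def by auto
  note nem = nem[folded Bm_def] and nep = nep[folded Bp_def]
  obtain Rm where Rm: "Rm \<in> carrier_mat m m" "Rm * char_matrix Bm \<beta> = 1\<^sub>m m"
    using char_matrix_inverse[OF Bm nem] by metis
  obtain Rp where Rp: "Rp \<in> carrier_mat p p" "char_matrix Bp \<beta> * Rp = 1\<^sub>m p"
    using char_matrix_inverse[OF Bp nep] by metis
  \<comment> \<open>The new line is attached through \<open>a\<close> if only the space after the x-point grows, through \<open>b\<close> if
    only the space before it grows, and through \<open>A\<close> if both do. In particular \<open>ar * bc = 0\<close>, as the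
    lower right block of the equation requires.\<close>
  define ar where "ar = mat j 1 (\<lambda>_. if k = 0 then 1 else 0 :: complex)"
  define bc where "bc = mat 1 k (\<lambda>_. if j = 0 then 1 else 0 :: complex)"
  define As where "As = mat j k (\<lambda>_. 1 :: complex)"
  \<comment> \<open>These solve \<open>(B\<^sup>+ - \<beta>) Ac + a bc = 0\<close> and \<open>Ar (B\<^sup>- - \<beta>) = ar b\<close>, the off-diagonal blocks of the
    equation between \<open>A\<close>, \<open>B\<^sup>\<plusminus>\<close>, \<open>a\<close> and \<open>b\<close>.\<close>
  define Ac where "Ac = Rp * (- (a * bc))"
  define Ar where "Ar = (ar * b) * Rm"
  define A' where "A' = four_block_mat A Ac Ar As"
  define a' where "a' = a @\<^sub>r ar"
  define b' where "b' = four_block_mat b bc (0\<^sub>m 0 m) (0\<^sub>m 0 k)"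
  have ar: "ar \<in> carrier_mat j 1" and bc: "bc \<in> carrier_mat 1 k" and As: "As \<in> carrier_mat j k"
    unfolding ar_def bc_def As_def by auto
  have Ac: "Ac \<in> carrier_mat p k" and Ar: "Ar \<in> carrier_mat j m"
    unfolding Ac_def Ar_def using Rp Rm a b ar bc by auto
  have A': "A' \<in> carrier_mat (p + j) (m + k)" and a': "a' \<in> carrier_mat (p + j) 1"
    and b': "b' \<in> carrier_mat 1 (m + k)"
    unfolding A'_def a'_def b'_def using A As a ar b bc
    by (auto simp: four_block_carrier_mat[of b 1 m "0\<^sub>m 0 k" 0 k, simplified])
  have A'_vec: "A' *\<^sub>v (u @\<^sub>v z) = (A *\<^sub>v u + Ac *\<^sub>v z) @\<^sub>v (Ar *\<^sub>v u + As *\<^sub>v z)"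
    if "u \<in> carrier_vec m" "z \<in> carrier_vec k" for u z
    unfolding A'_def by (rule four_block_mat_mult_vec[OF A Ac Ar As that])
  have a'_vec: "a' *\<^sub>v c = (a *\<^sub>v c) @\<^sub>v (ar *\<^sub>v c)" if "c \<in> carrier_vec 1" for c
    unfolding a'_def by (rule mat_mult_append[OF a ar that])
  have b'_vec: "b' *\<^sub>v (u @\<^sub>v z) = b *\<^sub>v u + bc *\<^sub>v z"
    if "u \<in> carrier_vec m" "z \<in> carrier_vec k" for u z
    unfolding b'_def by (rule append_cols_mult_vec[OF b bc that])
  have upper: "Bp * Ac + (- \<beta>) \<cdot>\<^sub>m Ac = - (a * bc)"
  proof -
    have "char_matrix Bp \<beta> * Ac = - (a * bc)"
      unfolding Ac_def using Rp Bp a bc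
      by (subst assoc_mult_mat[symmetric, of _ p p _ p _ k]) auto
    then show ?thesis using char_matrix_mult[OF Bp Ac] by simp
  qed
  have lower: "Ar * Bm + (- \<beta>) \<cdot>\<^sub>m Ar = ar * b"
  proof -
    have "Ar * char_matrix Bm \<beta> = ar * b"
      unfolding Ar_def using Rm Bm b ar
      by (subst assoc_mult_mat[of _ j m _ m _ m]) auto
    then show ?thesis using mult_char_matrix[OF Bm Ar] by simp
  qed
  have "ar * bc = 0\<^sub>m j k"
    by (intro eq_matI) (auto simp: ar_def bc_def scalar_prod_def)
  moreover have "enlarge j Bp \<beta> * A' = four_block_mat (Bp * A) (Bp * Ac) (\<beta> \<cdot>\<^sub>m Ar) (\<beta> \<cdot>\<^sub>m As)"
    unfolding enlarge_def A'_def
    using Bp A Ac Ar As mult_smult_assoc_mat[of "1\<^sub>m j" j j Ar m \<beta>]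
      mult_smult_assoc_mat[of "1\<^sub>m j" j j As k \<beta>]
    by (subst mult_four_block_mat[of _ p p _ j _ j _ _ m _ k]) auto
  moreover have "A' * enlarge k Bm \<beta> = four_block_mat (A * Bm) (\<beta> \<cdot>\<^sub>m Ac) (Ar * Bm) (\<beta> \<cdot>\<^sub>m As)"
    unfolding enlarge_def A'_def
    using Bm A Ac Ar As mult_smult_distrib[of Ac p k "1\<^sub>m k" k \<beta>]
      mult_smult_distrib[of As j k "1\<^sub>m k" k \<beta>]
    by (subst mult_four_block_mat[of _ p m _ k _ j _ _ m _ k]) auto
  moreover have "a' * b' = four_block_mat (a * b) (a * bc) (ar * b) (ar * bc)"
    unfolding append_rows_def a'_def b'_def using a b ar bc
    by (subst mult_four_block_mat[of _ p 1 _ 0 _ j _ _ m _ k]) auto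
  ultimately have rel': "enlarge j Bp \<beta> * A' - A' * enlarge k Bm \<beta> + a' * b' = 0\<^sub>m (p + j) (m + k)"
  proof (simp only:, intro eq_matI, goal_cases)
    case (1 r c)
    show ?case
    proof (cases "r < p"; cases "c < m")
      assume rc: "r < p" "c < m"
      then show ?thesis using arg_cong[OF rel, of "\<lambda>M. M $$ (r, c)"] A Bm Bp a b Ac Ar As ar bc
        by simp
    next
      assume rc: "r < p" "\<not> c < m"
      then show ?thesis using arg_cong[OF upper, of "\<lambda>M. M $$ (r, c - m)"] 1 A Bm Bp a b Ac Ar As ar bc
        by (simp add: algebra_simps)
    next
      assume rc: "\<not> r < p" "c < m"
      then show ?thesis using arg_cong[OF lower, of "\<lambda>M. M $$ (r - p, c)"] 1 A Bm Bp a b Ac Ar As ar bc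
        by (simp add: algebra_simps)
    next
      assume rc: "\<not> r < p" "\<not> c < m"
      then show ?thesis using 1 A Bm Bp a b Ac Ar As ar bc by simp
    qed
  qed (use A Bm Bp a b Ac Ar As ar bc in auto)
  have stable': "W = {0\<^sub>v (m + k)}"
    if "lin_subspace (m + k) W" "invariant_under (enlarge k Bm \<beta>) W"
      "W \<subseteq> mat_kernel A' \<inter> mat_kernel b'" for W
    using Bm nem A b stable _ _ _ that
  proof (rule stable_enlarge)
    show "A *\<^sub>v u = 0\<^sub>v p" if "u \<in> carrier_vec m" "u @\<^sub>v 0\<^sub>v k \<in> mat_kernel A'" for u
      using mat_kernelD(2)[OF A' that(2)] that(1) A'_vec[of u "0\<^sub>v k"] A Ac Ar As
        mult_zero_vec[OF Ac]
      by (simp add: append_vec_zero[symmetric] append_vec_eq[of _ p])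
    show "b *\<^sub>v u = 0\<^sub>v 1" if "u \<in> carrier_vec m" "u @\<^sub>v 0\<^sub>v k \<in> mat_kernel b'" for u
      using mat_kernelD(2)[OF b' that(2)] that(1) b'_vec[of u "0\<^sub>v k"] b mult_zero_vec[OF bc]
      by simp
    show "z = 0\<^sub>v k" if z: "z \<in> carrier_vec k" and "0\<^sub>v m @\<^sub>v z \<in> mat_kernel A' \<inter> mat_kernel b'" for z
    proof -
      from that have As_z: "As *\<^sub>v z = 0\<^sub>v j" and bc_z: "bc *\<^sub>v z = 0\<^sub>v 1"
        using mat_kernelD(2)[OF A', of "0\<^sub>v m @\<^sub>v z"] mat_kernelD(2)[OF b', of "0\<^sub>v m @\<^sub>v z"]
          A'_vec[of "0\<^sub>v m" z] b'_vec[of "0\<^sub>v m" z] A Ac Ar As b bc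
          mult_zero_vec[OF Ar] mult_zero_vec[OF b]
        by (simp_all add: append_vec_zero[symmetric] append_vec_eq[of _ p])
      show ?thesis
      proof (cases "k = 0")
        case True
        then show ?thesis using z by (intro eq_vecI) auto
      next
        case False
        with k have k1: "k = 1" by simp
        then have "z = mat 1 1 (\<lambda>_. 1) *\<^sub>v z"
          using one_by_one_mult_vec[of z 1] z by simp
        also have "\<dots> = 0\<^sub>v 1"
        proof (cases "j = 0")
          case True
          with bc_z k1 show ?thesis unfolding bc_def by simp
        next
          case False
          with j have "j = 1" by simp
          with As_z k1 show ?thesis unfolding As_def by simp
        qed
        finally show ?thesis using k1 by simp
      qed
    qed
  qed
  have costable': "W = carrier_vec (p + j)"
    if "lin_subspace (p + j) W" "invariant_under (enlarge j Bp \<beta>) W"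
      "{A' *\<^sub>v u + a' *\<^sub>v c | u c. u \<in> carrier_vec (m + k) \<and> c \<in> carrier_vec 1} \<subseteq> W" for W
    using Bp nep costable _ _ _ that
  proof (rule costable_enlarge)
    let ?G = "{A *\<^sub>v u + a *\<^sub>v c | u c. u \<in> carrier_vec m \<and> c \<in> carrier_vec 1}"
    let ?G' = "{A' *\<^sub>v u + a' *\<^sub>v c | u c. u \<in> carrier_vec (m + k) \<and> c \<in> carrier_vec 1}"
    have G': "(A *\<^sub>v u + Ac *\<^sub>v z + a *\<^sub>v c) @\<^sub>v (Ar *\<^sub>v u + As *\<^sub>v z + ar *\<^sub>v c) \<in> ?G'"
      if "u \<in> carrier_vec m" "z \<in> carrier_vec k" "c \<in> carrier_vec 1" for u z c
      using that A'_vec[OF that(1,2)] a'_vec[OF that(3)] A Ac Ar As a ar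
      by (intro CollectI exI[of _ "u @\<^sub>v z"] exI[of _ c])
        (auto simp: append_vec_add[where n = p and m = j])
    show "?G \<subseteq> carrier_vec p" using A a by auto
    show "\<exists>z\<in>carrier_vec j. g @\<^sub>v z \<in> ?G'" if g: "g \<in> ?G" for g
    proof -
      obtain u c where uc: "u \<in> carrier_vec m" "c \<in> carrier_vec 1" "g = A *\<^sub>v u + a *\<^sub>v c"
        using g by blast
      show ?thesis
        using G'[OF uc(1) _ uc(2), of "0\<^sub>v k"] uc A Ac Ar As a ar mult_zero_vec[OF Ac]
        by (intro bexI[of _ "Ar *\<^sub>v u + As *\<^sub>v 0\<^sub>v k + ar *\<^sub>v c"]) simp_all
    qed
    show "\<exists>u\<in>carrier_vec p. u @\<^sub>v z \<in> ?G'" if z: "z \<in> carrier_vec j" for z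
    proof -
      have "\<exists>y\<in>carrier_vec k. \<exists>c\<in>carrier_vec 1. As *\<^sub>v y + ar *\<^sub>v c = z"
      proof (cases "j = 0")
        case True
        then show ?thesis using As ar z
          by (intro bexI[of _ "0\<^sub>v k"] bexI[of _ "0\<^sub>v 1"]) (auto intro!: eq_vecI)
      next
        case False
        with j have j1: "j = 1" by simp
        show ?thesis
        proof (cases "k = 0")
          case True
          then show ?thesis using z j1 unfolding As_def ar_def
            by (intro bexI[of _ "0\<^sub>v k"] bexI[of _ z]) (auto intro!: eq_vecI simp: scalar_prod_def)
        next
          case False
          with k have "k = 1" by simp
          then show ?thesis using z j1 unfolding As_def ar_def
            by (intro bexI[of _ z] bexI[of _ "0\<^sub>v 1"]) (auto intro!: eq_vecI simp: scalar_prod_def)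
        qed
      qed
      then obtain y c where "y \<in> carrier_vec k" "c \<in> carrier_vec 1" "As *\<^sub>v y + ar *\<^sub>v c = z"
        by blast
      then show ?thesis using G'[of "0\<^sub>v m" y c] A Ac Ar As a ar mult_zero_vec[OF Ar]
        by (intro bexI[of _ "A *\<^sub>v 0\<^sub>v m + Ac *\<^sub>v y + a *\<^sub>v c"]) auto
    qed
  qed
  let ?d' = "\<lparr>Ax = A', Bminus = enlarge k Bm \<beta>, Bplus = enlarge j Bp \<beta>, ax = a', bx = b'\<rparr>"
  have "?d' \<in> xpoint_space (m + k) (p + j)"
  proof -
    have "\<not> (\<exists>W. lin_subspace (m + k) W \<and> W \<noteq> {0\<^sub>v (m + k)} \<and>
        invariant_under (enlarge k Bm \<beta>) W \<and> W \<subseteq> mat_kernel A' \<inter> mat_kernel b')"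
      using stable' by blast
    moreover have "\<not> (\<exists>W. lin_subspace (p + j) W \<and> W \<noteq> carrier_vec (p + j) \<and>
        invariant_under (enlarge j Bp \<beta>) W \<and>
        {A' *\<^sub>v u + a' *\<^sub>v c | u c. u \<in> carrier_vec (m + k) \<and> c \<in> carrier_vec 1} \<subseteq> W)"
      using costable' by blast
    ultimately show ?thesis
      unfolding xpoint_space_def mem_Collect_eq xpoint_data.simps
      using A' a' b' enlarge_carrier[OF Bm] enlarge_carrier[OF Bp] rel'
      by (intro conjI)
  qed
  then show ?thesis by (rule bexI[rotated]) (simp add: Bm_def Bp_def)
qed

lemma arrow_space_enlarge:
  assumes "d \<in> arrow_space m p"
  shows "\<exists>d'\<in>arrow_space (m + k) (p + k).
    Ce d' * De d' = enlarge k (Ce d * De d) q \<and> De d' * Ce d' = enlarge k (De d * Ce d) q"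
proof -
  have C: "Ce d \<in> carrier_mat p m" and D: "De d \<in> carrier_mat m p"
    using assms unfolding arrow_space_def by auto
  show ?thesis
    using enlarge_mult[OF C D, of k q 1] enlarge_mult[OF D C, of k 1 q] C D
    by (intro bexI[of _ "\<lparr>Ce = enlarge k (Ce d) q, De = enlarge k (De d) 1\<rparr>"])
      (auto simp: arrow_space_def)
qed

section \<open>Incrementing the dimensions on an arc\<close>

lemma seg_before_Suc_mod:
  assumes "s < size_bow B"
  shows "seg_before B ((s + 1) mod size_bow B) = s"
proof (cases "s + 1 = size_bow B")
  case True
  then show ?thesis using assms by (simp add: seg_before_def)
next
  case False
  with assms have "s + 1 < size_bow B" by simp
  then show ?thesis by (simp add: seg_before_def)
qed

text \<open>
  Dimension vectors are functions on all natural numbers, and a supersymmetric increment constrains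
  the new one on segments only.
\<close>

lemma moment_fibre_cong:
  assumes "\<And>s. s \<in> segments B \<Longrightarrow> v s = v' s"
  shows "moment_fibre B v l = moment_fibre B v' l"
proof -
  have before: "v (seg_before B i) = v' (seg_before B i)" if "i < size_bow B" for i
  proof -
    have "seg_before B i < size_bow B" using that unfolding seg_before_def by auto
    then show ?thesis using assms unfolding segments_def by auto
  qed
  have "M_tilde B v = M_tilde B v'"
    unfolding M_tilde_def
    by (intro arg_cong2[where f = "(\<times>)"] PiE_cong)
      (use assms before in \<open>auto simp: xpoints_def arrows_def seg_after_def segments_def\<close>)
  moreover have "param_mat B v l s = param_mat B v' l s" if "s \<in> segments B" for s
    using assms[OF that] unfolding param_mat_def by simp
  ultimately show ?thesis unfolding moment_fibre_def by auto
qed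

text \<open>
  The scalar by which the parameter acts on a segment, in whatever dimension.
\<close>

definition param_at :: "bow \<Rightarrow> (nat \<Rightarrow> complex) \<Rightarrow> nat \<Rightarrow> complex" where
  "param_at B l s = (if s \<in> wavy_lines B then l s else 0)"

lemma finite_eigenvalues_shifted:
  assumes "(M :: complex mat) \<in> carrier_mat n n"
  shows "finite {t. eigenvalue M (- (t + c))}"
proof -
  have "{t. eigenvalue M (- (t + c))} \<subseteq> (\<lambda>\<beta>. - \<beta> - c) ` spectrum M"
    unfolding spectrum_def by (auto intro!: image_eqI[where x = "- (_ + c)"])
  then show ?thesis using card_finite_spectrum(1)[OF assms] finite_surj by blast
qed

text \<open>
  \<open>S\<close> stands for an arc bounded by x-points: an arrow never separates a segment in \<open>S\<close> from one outside.
  The hypothesis on \<open>c\<close> is the moment map equation on the new lines. It determines the numbers \<open>q\<^sub>i\<close>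
  up to the common constant \<open>t\<close>, which is chosen so that no \<open>- q\<^sub>i\<close> is an eigenvalue of the given \<open>B\<^sub>i\<^sup>\<plusminus>\<close>.
\<close>

lemma moment_fibre_increment_arc:
  assumes nonneg: "\<And>s. s \<in> segments B \<Longrightarrow> v s \<ge> 0"
    and boundary: "\<And>i. i \<in> arrows B \<Longrightarrow> seg_before B i \<in> S \<longleftrightarrow> i \<in> S"
    and c: "\<And>s. s \<in> segments B \<Longrightarrow> s \<in> S \<Longrightarrow>
      c s - c ((s + 1) mod size_bow B) = param_at B l s"
    and ne: "moment_fibre B v l \<noteq> {}"
  shows "moment_fibre B (\<lambda>s. v s + of_bool (s \<in> S)) l \<noteq> {}"
proof -
  let ?k = "\<lambda>s. of_bool (s \<in> S) :: nat"
  let ?v' = "\<lambda>s. v s + of_bool (s \<in> S)"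
  obtain X E where "(X, E) \<in> moment_fibre B v l" using ne by auto
  then have X: "\<And>i. i \<in> xpoints B \<Longrightarrow> X i \<in> xpoint_space (nat (v (seg_before B i))) (nat (v i))"
    and E: "\<And>i. i \<in> arrows B \<Longrightarrow> E i \<in> arrow_space (nat (v (seg_before B i))) (nat (v i))"
    and mu: "\<And>s. s \<in> segments B \<Longrightarrow> moment_map B (X, E) s = param_mat B v l s"
    unfolding moment_fibre_def M_tilde_def by (auto simp: seg_after_def)
  have "finite (\<Union>i\<in>xpoints B. {t. eigenvalue (Bminus (X i)) (- (t + c i))} \<union>
      {t. eigenvalue (Bplus (X i)) (- (t + c i))})" (is "finite ?bad")
  proof (rule finite_UN_I)
    show "finite (xpoints B)" unfolding xpoints_def by auto
    show "finite ({t. eigenvalue (Bminus (X i)) (- (t + c i))} \<union>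
      {t. eigenvalue (Bplus (X i)) (- (t + c i))})" if "i \<in> xpoints B" for i
    proof -
      have "Bminus (X i) \<in> carrier_mat (nat (v (seg_before B i))) (nat (v (seg_before B i)))"
        "Bplus (X i) \<in> carrier_mat (nat (v i)) (nat (v i))"
        using X[OF that] unfolding xpoint_space_def by auto
      from this[THEN finite_eigenvalues_shifted] show ?thesis by blast
    qed
  qed
  then obtain t where t: "t \<notin> ?bad"
    using ex_new_if_finite[OF infinite_UNIV_char_0] by blast
  define q where "q i = t + c i" for i
  have before_seg: "seg_before B i \<in> segments B" if "i < size_bow B" for i
    using that unfolding seg_before_def segments_def by auto
  have nat': "nat (?v' s) = nat (v s) + ?k s" if "s \<in> segments B" for s
    using nonneg[OF that] by auto
  have "\<forall>i\<in>xpoints B. \<exists>d'. d' \<in> xpoint_space (nat (?v' (seg_before B i))) (nat (?v' i)) \<and>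
      Bminus d' = enlarge (?k (seg_before B i)) (Bminus (X i)) (- q i) \<and>
      Bplus d' = enlarge (?k i) (Bplus (X i)) (- q i)"
  proof
    fix i assume i: "i \<in> xpoints B"
    then have "i < size_bow B" unfolding xpoints_def by simp
    then have "i \<in> segments B" "seg_before B i \<in> segments B"
      using before_seg unfolding segments_def by auto
    moreover have "\<not> eigenvalue (Bminus (X i)) (- q i)" "\<not> eigenvalue (Bplus (X i)) (- q i)"
      using t i unfolding q_def by auto
    ultimately show "\<exists>d'. d' \<in> xpoint_space (nat (?v' (seg_before B i))) (nat (?v' i)) \<and>
      Bminus d' = enlarge (?k (seg_before B i)) (Bminus (X i)) (- q i) \<and>
      Bplus d' = enlarge (?k i) (Bplus (X i)) (- q i)"
      using xpoint_space_enlarge[OF X[OF i], of "- q i" "?k (seg_before B i)" "?k i"]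
      unfolding nat'[OF \<open>i \<in> segments B\<close>] nat'[OF \<open>seg_before B i \<in> segments B\<close>] Bex_def
      by simp
  qed
  from bchoice[OF this] obtain X' where
    X': "\<And>i. i \<in> xpoints B \<Longrightarrow> X' i \<in> xpoint_space (nat (?v' (seg_before B i))) (nat (?v' i))"
    and X'_minus: "\<And>i. i \<in> xpoints B \<Longrightarrow>
      Bminus (X' i) = enlarge (?k (seg_before B i)) (Bminus (X i)) (- q i)"
    and X'_plus: "\<And>i. i \<in> xpoints B \<Longrightarrow> Bplus (X' i) = enlarge (?k i) (Bplus (X i)) (- q i)"
    by blast
  have "\<forall>i\<in>arrows B. \<exists>d'. d' \<in> arrow_space (nat (?v' (seg_before B i))) (nat (?v' i)) \<and>
      Ce d' * De d' = enlarge (?k i) (Ce (E i) * De (E i)) (q i) \<and>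
      De d' * Ce d' = enlarge (?k i) (De (E i) * Ce (E i)) (q i)"
  proof
    fix i assume i: "i \<in> arrows B"
    then have "i < size_bow B" unfolding arrows_def by simp
    then have "i \<in> segments B" "seg_before B i \<in> segments B"
      using before_seg unfolding segments_def by auto
    then show "\<exists>d'. d' \<in> arrow_space (nat (?v' (seg_before B i))) (nat (?v' i)) \<and>
      Ce d' * De d' = enlarge (?k i) (Ce (E i) * De (E i)) (q i) \<and>
      De d' * Ce d' = enlarge (?k i) (De (E i) * Ce (E i)) (q i)"
      using arrow_space_enlarge[OF E[OF i], of "?k i" "q i"] boundary[OF i]
      unfolding nat'[OF \<open>i \<in> segments B\<close>] nat'[OF \<open>seg_before B i \<in> segments B\<close>] by auto
  qed
  from bchoice[OF this] obtain E' where
    E': "\<And>i. i \<in> arrows B \<Longrightarrow> E' i \<in> arrow_space (nat (?v' (seg_before B i))) (nat (?v' i))"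
    and E'_head: "\<And>i. i \<in> arrows B \<Longrightarrow>
      Ce (E' i) * De (E' i) = enlarge (?k i) (Ce (E i) * De (E i)) (q i)"
    and E'_tail: "\<And>i. i \<in> arrows B \<Longrightarrow>
      De (E' i) * Ce (E' i) = enlarge (?k i) (De (E i) * Ce (E i)) (q i)"
    by blast
  let ?p' = "(restrict X' (xpoints B), restrict E' (arrows B))"
  have "?p' \<in> M_tilde B ?v'"
    unfolding M_tilde_def using X' E' by (auto simp: seg_after_def)
  moreover have "moment_map B ?p' s = param_mat B ?v' l s" if s: "s \<in> segments B" for s
  proof -
    define i where "i = (s + 1) mod size_bow B"
    let ?n = "nat (v s)"
    have size: "s < size_bow B" using s unfolding segments_def by simp
    then have i: "i < size_bow B" unfolding i_def by auto
    have prev: "seg_before B i = s" using seg_before_Suc_mod[OF size] unfolding i_def .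
    have before: "contrib_before B ?p' s = enlarge (?k s) (contrib_before B (X, E) s) (q s)"
      and before_carrier: "contrib_before B (X, E) s \<in> carrier_mat ?n ?n"
    proof (atomize (full), cases "circle B ! s")
      case Arrow
      then have "s \<in> arrows B" using size unfolding arrows_def by simp
      then show "contrib_before B ?p' s = enlarge (?k s) (contrib_before B (X, E) s) (q s) \<and>
          contrib_before B (X, E) s \<in> carrier_mat ?n ?n"
        using Arrow E'_head[of s] E[of s]
        by (auto simp: contrib_before_def elem_before_def arrow_space_def)
    next
      case XPoint
      then have "s \<in> xpoints B" using size unfolding xpoints_def by simp
      then show "contrib_before B ?p' s = enlarge (?k s) (contrib_before B (X, E) s) (q s) \<and>
          contrib_before B (X, E) s \<in> carrier_mat ?n ?n"
        using XPoint X'_plus[of s] X[of s]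
        by (auto simp: contrib_before_def elem_before_def xpoint_space_def enlarge_uminus)
    qed
    have elem: "elem_after B s = i" unfolding elem_after_def i_def ..
    have after: "contrib_after B ?p' s = enlarge (?k s) (contrib_after B (X, E) s) (- q i)"
      and after_carrier: "contrib_after B (X, E) s \<in> carrier_mat ?n ?n"
    proof (atomize (full), cases "circle B ! i")
      case Arrow
      then have "i \<in> arrows B" using i unfolding arrows_def by simp
      then show "contrib_after B ?p' s = enlarge (?k s) (contrib_after B (X, E) s) (- q i) \<and>
          contrib_after B (X, E) s \<in> carrier_mat ?n ?n"
        using Arrow E'_tail[of i] E[of i] boundary[of i]
        unfolding contrib_after_def elem Let_def prev
        by (auto simp: arrow_space_def enlarge_uminus)
    next
      case XPoint
      then have "i \<in> xpoints B" using i unfolding xpoints_def by simp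
      then show "contrib_after B ?p' s = enlarge (?k s) (contrib_after B (X, E) s) (- q i) \<and>
          contrib_after B (X, E) s \<in> carrier_mat ?n ?n"
        using XPoint X'_minus[of i] X[of i]
        unfolding contrib_after_def elem Let_def prev
        by (auto simp: xpoint_space_def)
    qed
    have "moment_map B ?p' s = enlarge (?k s) (param_mat B v l s) (q s - q i)"
      using enlarge_add[OF before_carrier after_carrier, of "?k s" "q s" "- q i"] mu[OF s]
      unfolding moment_map_def before after by simp
    also have "\<dots> = param_mat B ?v' l s"
    proof (cases "s \<in> S")
      case True
      then have "q s - q i = param_at B l s" using c[OF s] unfolding q_def i_def by simp
      then show ?thesis using nat'[OF s] True
        unfolding param_mat_def param_at_def
        by (auto simp: enlarge_scalar enlarge_zero)
    next
      case False
      then show ?thesis by (simp add: enlarge_0 param_mat_def)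
    qed
    finally show ?thesis .
  qed
  ultimately show ?thesis unfolding moment_fibre_def by blast
qed

lemma moment_fibre_increment_arc_iterate:
  assumes "\<And>s. s \<in> segments B \<Longrightarrow> v s \<ge> 0"
    and "\<And>i. i \<in> arrows B \<Longrightarrow> seg_before B i \<in> S \<longleftrightarrow> i \<in> S"
    and "\<And>s. s \<in> segments B \<Longrightarrow> s \<in> S \<Longrightarrow>
      c s - c ((s + 1) mod size_bow B) = param_at B l s"
    and "moment_fibre B v l \<noteq> {}"
  shows "moment_fibre B (\<lambda>s. v s + int n * of_bool (s \<in> S)) l \<noteq> {}"
proof (induction n)
  case 0
  then show ?case using assms(4) by simp
next
  case (Suc n)
  have "moment_fibre B (\<lambda>s. v s + int n * of_bool (s \<in> S) + of_bool (s \<in> S)) l \<noteq> {}"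
    using assms(1-3) Suc by (intro moment_fibre_increment_arc[where c = c]) (auto intro: add_nonneg_nonneg)
  then show ?case by (simp add: algebra_simps)
qed

text \<open>
  The increment is split into its parts on the arc \<open>{x..<x'}\<close> and on the complementary one. On each,
  minus a partial sum of the parameters serves as \<open>c\<close>.
\<close>

lemma moment_fibre_susy_increment:
  assumes susy: "susy_increment B v v'"
    and nonneg: "\<forall>s\<in>segments B. v s \<ge> 0" and ne: "moment_fibre B v l \<noteq> {}"
  shows "moment_fibre B v' l \<noteq> {}"
proof -
  let ?N = "size_bow B"
  obtain x x' where x: "x \<in> xpoints B" and x': "x' \<in> xpoints B" and less: "x < x'"
    and ge: "\<And>s. s \<in> segments B \<Longrightarrow> v' s - v s \<ge> 0"
    and const: "\<And>s t. s \<in> segments B \<Longrightarrow> t \<in> segments B \<Longrightarrow>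
      s \<in> {x..<x'} \<longleftrightarrow> t \<in> {x..<x'} \<Longrightarrow> v' s - v s = v' t - v t"
    using susy unfolding susy_increment_def by blast
  have size: "x < ?N" "x' < ?N" using x x' unfolding xpoints_def by auto
  have not_arrow: "i \<noteq> x \<and> i \<noteq> x'" if "i \<in> arrows B" for i
    using that x x' unfolding arrows_def xpoints_def by auto
  have boundary: "seg_before B i \<in> {x..<x'} \<longleftrightarrow> i \<in> {x..<x'}" if i: "i \<in> arrows B" for i
  proof (cases i)
    case 0
    then show ?thesis using not_arrow[OF i] size by (auto simp: seg_before_def)
  next
    case (Suc j)
    then have "seg_before B i = j" using i unfolding seg_before_def arrows_def by simp
    then show ?thesis using not_arrow[OF i] Suc by auto
  qed
  define P where "P i = (\<Sum>j<i. param_at B l j)" for i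
  define w where "w = (\<lambda>s. v s + int (nat (v' x - v x)) * of_bool (s \<in> {x..<x'}))"
  have "moment_fibre B w l \<noteq> {}"
    unfolding w_def
  proof (rule moment_fibre_increment_arc_iterate[where c = "\<lambda>i. - P i"])
    show "- P s - - P ((s + 1) mod ?N) = param_at B l s" if "s \<in> segments B" "s \<in> {x..<x'}" for s
      using that size by (simp add: P_def)
  qed (use nonneg boundary ne in auto)
  \<comment> \<open>The complementary arc runs from \<open>x'\<close> past the end of the list to \<open>x\<close>. On the part after the wrap
    the partial sums have to be continued by adding \<open>P (size_bow B)\<close>.\<close>
  then have "moment_fibre B (\<lambda>s. w s + int (nat (v' x' - v x')) * of_bool (s \<in> - {x..<x'})) l \<noteq> {}"
  proof (rule moment_fibre_increment_arc_iterate[rotated 3,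
        where c = "\<lambda>i. - P i - (if i \<le> x then P ?N else 0)"])
    fix s assume s: "s \<in> segments B" "s \<in> - {x..<x'}"
    show "- P s - (if s \<le> x then P ?N else 0) -
        (- P ((s + 1) mod ?N) - (if (s + 1) mod ?N \<le> x then P ?N else 0)) = param_at B l s"
    proof (cases "s + 1 = ?N")
      case True
      then have "P ?N = P s + param_at B l s" unfolding P_def by (metis Suc_eq_plus1 sum.lessThan_Suc)
      then show ?thesis using True s size less by (auto simp: P_def)
    next
      case False
      then show ?thesis using s less by (auto simp: P_def segments_def)
    qed
  qed (use nonneg boundary in \<open>auto simp: w_def\<close>)
  also have "moment_fibre B (\<lambda>s. w s + int (nat (v' x' - v x')) * of_bool (s \<in> - {x..<x'})) l =
    moment_fibre B v' l"
  proof (rule moment_fibre_cong)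
    fix s assume s: "s \<in> segments B"
    have seg: "x \<in> segments B" "x' \<in> segments B" using size unfolding segments_def by auto
    show "w s + int (nat (v' x' - v x')) * of_bool (s \<in> - {x..<x'}) = v' s"
      using const[OF s seg(1)] const[OF s seg(2)] ge[OF seg(1)] ge[OF seg(2)] less
      unfolding w_def by (cases "s \<in> {x..<x'}") auto
  qed
  finally show ?thesis .
qed

theorem corollary5p17:
  fixes B :: bow and v vnew :: "nat \<Rightarrow> int" and l :: "nat \<Rightarrow> complex"
  assumes "bow_diagram B"
    and "\<forall>s\<in>segments B. v s \<ge> 0"
    and "susy_increments B v vnew"
    and "moment_fibre B v l \<noteq> {}"
  shows "moment_fibre B vnew l \<noteq> {}"
proof -
  from assms(3) have "(\<forall>s\<in>segments B. vnew s \<ge> 0) \<and> moment_fibre B vnew l \<noteq> {}"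
    unfolding susy_increments_def
  proof (induction rule: rtranclp_induct)
    case base
    then show ?case using assms by blast
  next
    case (step v1 v2)
    have "v2 s \<ge> 0" if s: "s \<in> segments B" for s
    proof -
      have "v2 s - v1 s \<ge> 0" using step(2) s unfolding susy_increment_def by blast
      moreover have "v1 s \<ge> 0" using step.IH s by blast
      ultimately show ?thesis by simp
    qed
    then show ?case using step moment_fibre_susy_increment by blast
  qed
  then show ?thesis by blast
qed

end
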